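(* Let $f:A\to B$, $g:A\to C$, $\alpha:B\to D$ and $\beta:C\to D$ be ring homomorphisms, and let $\pi:B\times C\to B$ be the canonical projection. Then the following conditions are equivalent: \begin{enumerate} \item $\alpha\times_D\beta=A\bowtie^{f,g}(J,J')$ for some ideals $J$ of $B$ and $J'$ of $C$ with $f^{-1}(J)=g^{-1}(J')$; \item $\alpha\circ f=\beta\circ g$ and $(\alpha\circ\pi)(\alpha\times_D\beta)=(\alpha\circ f)(A)$. \end{enumerate}
   Context: All rings are commutative with unity, and ring homomorphisms are unital. The pullback is $\alpha\times_D\beta:=\{(b,c)\in B\times C\mid\alpha(b)=\beta(c)\}$. For ideals $J$ of $B$ and $J'$ of $C$ with $f^{-1}(J)=g^{-1}(J')$, the bi-amalgamation of $A$ with $(B,C)$ along $(J,J')$ with respect to $(f,g)$ is the subring of $B\times C$ $$A\bowtie^{f,g}(J,J'):=\{(f(a)+j,\,g(a)+j')\mid a\in A,\ (j,j')\in J\times J'\}.$$ *)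

theory Defs
  imports "HOL-Algebra.Algebra"
begin

text \<open>
  Rings are \<open>HOL-Algebra\<close> rings given by their carriers.  The pullback and the bi-amalgamation
  are introduced as subsets of the direct product \<open>RDirProd B C\<close>; their ring structure is the
  one inherited from \<open>RDirProd B C\<close> (see the two \<open>subring\<close> lemmas below), so that equality
  of the subrings is equality of the sets.  The ring \<open>D\<close> does not occur in
  the definition of the pullback because \<open>\<alpha>\<close> and \<open>\<beta>\<close> are total HOL functions.
\<close>

definition ring_pullback ::
  "('b, 'm) ring_scheme \<Rightarrow> ('c, 'n) ring_scheme \<Rightarrow> ('b \<Rightarrow> 'd) \<Rightarrow> ('c \<Rightarrow> 'd) \<Rightarrow> ('b \<times> 'c) set"
  where "ring_pullback B C \<alpha> \<beta> = {(b, c) \<in> carrier (RDirProd B C). \<alpha> b = \<beta> c}"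

definition ring_preimage :: "('a, 'm) ring_scheme \<Rightarrow> ('a \<Rightarrow> 'b) \<Rightarrow> 'b set \<Rightarrow> 'a set"
  where "ring_preimage A f J = {a \<in> carrier A. f a \<in> J}"

definition bi_amalgamation ::
  "('a, 'k) ring_scheme \<Rightarrow> ('b, 'm) ring_scheme \<Rightarrow> ('c, 'n) ring_scheme
    \<Rightarrow> ('a \<Rightarrow> 'b) \<Rightarrow> ('a \<Rightarrow> 'c) \<Rightarrow> 'b set \<Rightarrow> 'c set \<Rightarrow> ('b \<times> 'c) set"
  where "bi_amalgamation A B C f g J J' =
    {(f a \<oplus>\<^bsub>B\<^esub> j, g a \<oplus>\<^bsub>C\<^esub> j') | a j j'. a \<in> carrier A \<and> (j, j') \<in> J \<times> J'}"

lemma RDirProd_simps: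
  "(b, c) \<oplus>\<^bsub>RDirProd B C\<^esub> (b', c') = (b \<oplus>\<^bsub>B\<^esub> b', c \<oplus>\<^bsub>C\<^esub> c')"
  "(b, c) \<otimes>\<^bsub>RDirProd B C\<^esub> (b', c') = (b \<otimes>\<^bsub>B\<^esub> b', c \<otimes>\<^bsub>C\<^esub> c')"
  "\<one>\<^bsub>RDirProd B C\<^esub> = (\<one>\<^bsub>B\<^esub>, \<one>\<^bsub>C\<^esub>)"
  "\<zero>\<^bsub>RDirProd B C\<^esub> = (\<zero>\<^bsub>B\<^esub>, \<zero>\<^bsub>C\<^esub>)"
  by (simp_all add: RDirProd_def DirProd_def monoid.defs)

lemma RDirProd_a_inv:
  assumes "ring B" "ring C" "b \<in> carrier B" "c \<in> carrier C"
  shows "\<ominus>\<^bsub>RDirProd B C\<^esub> (b, c) = (\<ominus>\<^bsub>B\<^esub> b, \<ominus>\<^bsub>C\<^esub> c)"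
proof -
  interpret B: ring B by fact
  interpret C: ring C by fact
  interpret P: ring "RDirProd B C" by (rule RDirProd_ring) fact+
  show ?thesis
    by (rule P.minus_equality)
      (use assms in \<open>auto simp: RDirProd_simps RDirProd_carrier B.l_neg C.l_neg\<close>)
qed

lemma ring_pullback_subring:
  assumes "ring B" "ring C" "ring D" "\<alpha> \<in> ring_hom B D" "\<beta> \<in> ring_hom C D"
  shows "subring (ring_pullback B C \<alpha> \<beta>) (RDirProd B C)"
proof -
  interpret B: ring B by fact
  interpret C: ring C by fact
  interpret D: ring D by fact
  interpret P: ring "RDirProd B C" by (rule RDirProd_ring) fact+
  interpret a: ring_hom_ring B D \<alpha> by (rule ring_hom_ringI2) fact+
  interpret b: ring_hom_ring C D \<beta> by (rule ring_hom_ringI2) fact+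
  show ?thesis
    by (rule P.subringI)
      (auto simp: ring_pullback_def RDirProd_simps RDirProd_carrier RDirProd_a_inv assms)
qed

lemma bi_amalgamation_subring:
  assumes "cring A" "cring B" "cring C" "f \<in> ring_hom A B" "g \<in> ring_hom A C"
    and "ideal J B" "ideal J' C"
  shows "subring (bi_amalgamation A B C f g J J') (RDirProd B C)"
proof -
  interpret A: cring A by fact
  interpret B: cring B by fact
  interpret C: cring C by fact
  interpret P: ring "RDirProd B C" by (rule RDirProd_ring) unfold_locales
  interpret f: ring_hom_ring A B f by (rule ring_hom_ringI2) (unfold_locales, fact)
  interpret g: ring_hom_ring A C g by (rule ring_hom_ringI2) (unfold_locales, fact)
  interpret J: ideal J B by fact
  interpret J': ideal J' C by fact
  have mem: "(f a \<oplus>\<^bsub>B\<^esub> j, g a \<oplus>\<^bsub>C\<^esub> j') \<in> bi_amalgamation A B C f g J J'"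
    if "a \<in> carrier A" "j \<in> J" "j' \<in> J'" for a j j'
    using that by (auto simp: bi_amalgamation_def)
  have cases: thesis
    if "h \<in> bi_amalgamation A B C f g J J'"
      "\<And>a j j'. h = (f a \<oplus>\<^bsub>B\<^esub> j, g a \<oplus>\<^bsub>C\<^esub> j') \<Longrightarrow> a \<in> carrier A \<Longrightarrow> j \<in> J \<Longrightarrow> j' \<in> J' \<Longrightarrow> thesis"
    for h thesis
    using that by (auto simp: bi_amalgamation_def)
  show ?thesis
  proof (rule P.subringI)
    show "bi_amalgamation A B C f g J J' \<subseteq> carrier (RDirProd B C)"
      by (auto simp: bi_amalgamation_def RDirProd_carrier)
    show "\<one>\<^bsub>RDirProd B C\<^esub> \<in> bi_amalgamation A B C f g J J'"
      using mem[of "\<one>\<^bsub>A\<^esub>" "\<zero>\<^bsub>B\<^esub>" "\<zero>\<^bsub>C\<^esub>"] by (simp add: RDirProd_simps)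
  next
    fix h assume "h \<in> bi_amalgamation A B C f g J J'"
    then show "\<ominus>\<^bsub>RDirProd B C\<^esub> h \<in> bi_amalgamation A B C f g J J'"
    proof (rule cases)
      fix a j j' assume h: "h = (f a \<oplus>\<^bsub>B\<^esub> j, g a \<oplus>\<^bsub>C\<^esub> j')" and *: "a \<in> carrier A" "j \<in> J" "j' \<in> J'"
      then show ?thesis
        using mem[of "\<ominus>\<^bsub>A\<^esub> a" "\<ominus>\<^bsub>B\<^esub> j" "\<ominus>\<^bsub>C\<^esub> j'"]
        by (simp add: RDirProd_a_inv B.ring_axioms C.ring_axioms B.minus_add C.minus_add)
    qed
  next
    fix h1 h2
    assume "h1 \<in> bi_amalgamation A B C f g J J'" "h2 \<in> bi_amalgamation A B C f g J J'"
    then obtain a j j' b i i' where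
      h: "h1 = (f a \<oplus>\<^bsub>B\<^esub> j, g a \<oplus>\<^bsub>C\<^esub> j')" "h2 = (f b \<oplus>\<^bsub>B\<^esub> i, g b \<oplus>\<^bsub>C\<^esub> i')"
      and *: "a \<in> carrier A" "j \<in> J" "j' \<in> J'" "b \<in> carrier A" "i \<in> J" "i' \<in> J'"
      by (metis cases)
    have B: "(f a \<oplus>\<^bsub>B\<^esub> j) \<otimes>\<^bsub>B\<^esub> (f b \<oplus>\<^bsub>B\<^esub> i)
        = f (a \<otimes>\<^bsub>A\<^esub> b) \<oplus>\<^bsub>B\<^esub> (j \<otimes>\<^bsub>B\<^esub> f b \<oplus>\<^bsub>B\<^esub> (f a \<oplus>\<^bsub>B\<^esub> j) \<otimes>\<^bsub>B\<^esub> i)"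
      using * by (simp add: B.l_distr B.r_distr B.a_ac)
    have C: "(g a \<oplus>\<^bsub>C\<^esub> j') \<otimes>\<^bsub>C\<^esub> (g b \<oplus>\<^bsub>C\<^esub> i')
        = g (a \<otimes>\<^bsub>A\<^esub> b) \<oplus>\<^bsub>C\<^esub> (j' \<otimes>\<^bsub>C\<^esub> g b \<oplus>\<^bsub>C\<^esub> (g a \<oplus>\<^bsub>C\<^esub> j') \<otimes>\<^bsub>C\<^esub> i')"
      using * by (simp add: C.l_distr C.r_distr C.a_ac)
    show "h1 \<otimes>\<^bsub>RDirProd B C\<^esub> h2 \<in> bi_amalgamation A B C f g J J'"
      unfolding h RDirProd_simps B C
      by (rule mem) (use * in \<open>simp_all add: J.I_l_closed J'.I_l_closed J.I_r_closed J'.I_r_closed\<close>)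
    have B': "(f a \<oplus>\<^bsub>B\<^esub> j) \<oplus>\<^bsub>B\<^esub> (f b \<oplus>\<^bsub>B\<^esub> i) = f (a \<oplus>\<^bsub>A\<^esub> b) \<oplus>\<^bsub>B\<^esub> (j \<oplus>\<^bsub>B\<^esub> i)"
      using * by (simp add: B.a_ac)
    have C': "(g a \<oplus>\<^bsub>C\<^esub> j') \<oplus>\<^bsub>C\<^esub> (g b \<oplus>\<^bsub>C\<^esub> i') = g (a \<oplus>\<^bsub>A\<^esub> b) \<oplus>\<^bsub>C\<^esub> (j' \<oplus>\<^bsub>C\<^esub> i')"
      using * by (simp add: C.a_ac)
    show "h1 \<oplus>\<^bsub>RDirProd B C\<^esub> h2 \<in> bi_amalgamation A B C f g J J'"
      unfolding h RDirProd_simps B' C' by (rule mem) (use * in auto)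
  qed
qed

end

theory Submission
  imports Defs
begin

text \<open>
  If the pullback is a bi-amalgamation along \<open>(J, J')\<close>, then it contains \<open>J \<times> {0}\<close>, so \<open>\<alpha>\<close>
  vanishes on \<open>J\<close> and only the values \<open>\<alpha> (f a)\<close> survive.  Conversely, the kernels of \<open>\<alpha>\<close> and
  \<open>\<beta>\<close> serve as \<open>J\<close> and \<open>J'\<close>: if \<open>(b, c)\<close> is in the pullback and \<open>\<alpha> b = \<alpha> (f a)\<close>, then
  \<open>b - f a\<close> and \<open>c - g a\<close> lie in these kernels.
\<close>

text \<open>The witness is the difference \<open>y \<ominus> x\<close>, which \<open>h\<close> kills
  exactly when the two values agree. This turns the decompositions \<open>f a + j\<close> and
  \<open>g a + j'\<close> of a bi-amalgamation along kernels into equations in the target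
  ring.\<close>

lemma (in ring_hom_ring) bex_a_kernel_decomp_iff:
  assumes "x \<in> carrier R" "y \<in> carrier R"
  shows "(\<exists>k \<in> a_kernel R S h. y = x \<oplus>\<^bsub>R\<^esub> k) \<longleftrightarrow> h y = h x"
proof
  assume "h y = h x"
  then have "y \<ominus>\<^bsub>R\<^esub> x \<in> a_kernel R S h"
    unfolding a_kernel_def' using assms by (simp add: R.minus_eq S.r_neg)
  moreover have "y = x \<oplus>\<^bsub>R\<^esub> (y \<ominus>\<^bsub>R\<^esub> x)"
    using assms by (simp add: R.minus_eq R.a_lcomm[of x y] R.r_neg)
  ultimately show "\<exists>k \<in> a_kernel R S h. y = x \<oplus>\<^bsub>R\<^esub> k" ..
next
  assume "\<exists>k \<in> a_kernel R S h. y = x \<oplus>\<^bsub>R\<^esub> k"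
  then obtain k where "k \<in> carrier R" "h k = \<zero>\<^bsub>S\<^esub>" "y = x \<oplus>\<^bsub>R\<^esub> k"
    unfolding a_kernel_def' by blast
  then show "h y = h x"
    using assms by simp
qed

theorem proposition3p3:
  fixes A :: "('a, 'k) ring_scheme" and B :: "('b, 'm) ring_scheme"
    and C :: "('c, 'n) ring_scheme" and D :: "('d, 'l) ring_scheme"
    and f :: "'a \<Rightarrow> 'b" and g :: "'a \<Rightarrow> 'c" and \<alpha> :: "'b \<Rightarrow> 'd" and \<beta> :: "'c \<Rightarrow> 'd"
  assumes "cring A" and "cring B" and "cring C" and "cring D"
    and "f \<in> ring_hom A B" and "g \<in> ring_hom A C"
    and "\<alpha> \<in> ring_hom B D" and "\<beta> \<in> ring_hom C D"
  shows "(\<exists>J J'. ideal J B \<and> ideal J' C \<and> ring_preimage A f J = ring_preimage A g J' \<and>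
            ring_pullback B C \<alpha> \<beta> = bi_amalgamation A B C f g J J')
     \<longleftrightarrow> ((\<forall>a \<in> carrier A. (\<alpha> \<circ> f) a = (\<beta> \<circ> g) a) \<and>
          (\<alpha> \<circ> fst) ` ring_pullback B C \<alpha> \<beta> = (\<alpha> \<circ> f) ` carrier A)"
    (is "?bi \<longleftrightarrow> ?comm \<and> ?img")
proof -
  interpret A: cring A by fact
  interpret B: cring B by fact
  interpret C: cring C by fact
  interpret D: cring D by fact
  interpret f: ring_hom_ring A B f by (rule ring_hom_ringI2) (unfold_locales, fact)
  interpret g: ring_hom_ring A C g by (rule ring_hom_ringI2) (unfold_locales, fact)
  interpret \<alpha>: ring_hom_ring B D \<alpha> by (rule ring_hom_ringI2) (unfold_locales, fact)
  interpret \<beta>: ring_hom_ring C D \<beta> by (rule ring_hom_ringI2) (unfold_locales, fact)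
  show ?thesis
  proof
    assume ?bi
    then obtain J J' where "ideal J B" "ideal J' C"
      and eq: "ring_pullback B C \<alpha> \<beta> = bi_amalgamation A B C f g J J'"
      by blast
    then interpret J: ideal J B + J': ideal J' C by simp_all
    have mem: "(f a \<oplus>\<^bsub>B\<^esub> j, g a \<oplus>\<^bsub>C\<^esub> j') \<in> ring_pullback B C \<alpha> \<beta>"
      if "a \<in> carrier A" "j \<in> J" "j' \<in> J'" for a j j'
      using that by (auto simp: eq bi_amalgamation_def)
    then have pb: "\<alpha> (f a \<oplus>\<^bsub>B\<^esub> j) = \<beta> (g a \<oplus>\<^bsub>C\<^esub> j')"
      if "a \<in> carrier A" "j \<in> J" "j' \<in> J'" for a j j'
      using that by (simp add: ring_pullback_def)
    \<comment> \<open>Both ideal components are set to zero.\<close>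
    have comm: ?comm
      using pb[of _ "\<zero>\<^bsub>B\<^esub>" "\<zero>\<^bsub>C\<^esub>"] by simp
    \<comment> \<open>With \<open>a\<close> and the second ideal component zero, the pair is
      \<open>(j, 0)\<close>, so \<alpha> sends \<open>j\<close> to the \<beta>-value of
      zero.\<close>
    have J0: "\<alpha> j = \<zero>\<^bsub>D\<^esub>" if "j \<in> J" for j
      using pb[of "\<zero>\<^bsub>A\<^esub>" j "\<zero>\<^bsub>C\<^esub>"] that by (simp add: J.Icarr)
    have ?img
    proof (intro equalityI image_subsetI)
      fix p assume "p \<in> ring_pullback B C \<alpha> \<beta>"
      then obtain a j where "a \<in> carrier A" "j \<in> J" "fst p = f a \<oplus>\<^bsub>B\<^esub> j"
        by (auto simp: eq bi_amalgamation_def)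
      then have "(\<alpha> \<circ> fst) p = (\<alpha> \<circ> f) a"
        by (simp add: J0 J.Icarr)
      with \<open>a \<in> carrier A\<close> show "(\<alpha> \<circ> fst) p \<in> (\<alpha> \<circ> f) ` carrier A"
        by blast
    next
      fix a assume "a \<in> carrier A"
      then have "(f a, g a) \<in> ring_pullback B C \<alpha> \<beta>"
        using mem[of a "\<zero>\<^bsub>B\<^esub>" "\<zero>\<^bsub>C\<^esub>"] by simp
      then show "(\<alpha> \<circ> f) a \<in> (\<alpha> \<circ> fst) ` ring_pullback B C \<alpha> \<beta>"
        by (rule rev_image_eqI) simp
    qed
    with comm show "?comm \<and> ?img" ..
  next
    assume "?comm \<and> ?img"
    then have comm: "\<And>a. a \<in> carrier A \<Longrightarrow> \<beta> (g a) = \<alpha> (f a)" and img: ?img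
      by simp_all
    let ?J = "a_kernel B D \<alpha>" and ?J' = "a_kernel C D \<beta>"
    have "(b, c) \<in> ring_pullback B C \<alpha> \<beta> \<longleftrightarrow> (b, c) \<in> bi_amalgamation A B C f g ?J ?J'" for b c
    \<comment> \<open>The kernel criterion speaks only of carrier elements; a pair with a coordinate
      outside its carrier lies in neither set.\<close>
    proof (cases "b \<in> carrier B \<and> c \<in> carrier C")
      case True
      \<comment> \<open>The two ideal components are chosen independently, but one \<open>a\<close>
        must serve both coordinates.\<close>
      have "(b, c) \<in> bi_amalgamation A B C f g ?J ?J' \<longleftrightarrow>
          (\<exists>a \<in> carrier A. (\<exists>j \<in> ?J. b = f a \<oplus>\<^bsub>B\<^esub> j) \<and> (\<exists>j' \<in> ?J'. c = g a \<oplus>\<^bsub>C\<^esub> j'))"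
        by (auto simp: bi_amalgamation_def)
      \<comment> \<open>Commutativity replaces \<open>\<beta> (g a)\<close> by
        \<open>\<alpha> (f a)\<close>, so both coordinates are compared with the same value.\<close>
      also have "\<dots> \<longleftrightarrow> (\<exists>a \<in> carrier A. \<alpha> b = \<alpha> (f a) \<and> \<beta> c = \<alpha> (f a))"
        using True by (simp add: \<alpha>.bex_a_kernel_decomp_iff \<beta>.bex_a_kernel_decomp_iff comm)
      also have "\<dots> \<longleftrightarrow> \<alpha> b = \<beta> c \<and> \<alpha> b \<in> (\<alpha> \<circ> f) ` carrier A"
        by auto
      \<comment> \<open>By the image hypothesis, the second conjunct says that
        \<open>\<alpha> b\<close> is attained on the pullback; once
        \<open>\<alpha> b = \<beta> c\<close>, the pair \<open>(b, c)\<close> itself witnesses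
        this.\<close>
      also have "\<dots> \<longleftrightarrow> (b, c) \<in> ring_pullback B C \<alpha> \<beta>"
        unfolding img[symmetric] using True by (force simp: ring_pullback_def RDirProd_carrier)
      finally show ?thesis ..
    next
      case False
      then have "(b, c) \<notin> carrier (RDirProd B C)"
        by (simp add: RDirProd_carrier)
      moreover have "ring_pullback B C \<alpha> \<beta> \<subseteq> carrier (RDirProd B C)"
        by (auto simp: ring_pullback_def)
      moreover have "bi_amalgamation A B C f g ?J ?J' \<subseteq> carrier (RDirProd B C)"
        by (rule subringE(1)[OF bi_amalgamation_subring])
          (fact assms \<alpha>.kernel_is_ideal \<beta>.kernel_is_ideal)+
      ultimately show ?thesis
        by blast
    qed
    then have "ring_pullback B C \<alpha> \<beta> = bi_amalgamation A B C f g ?J ?J'"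
      by (simp add: set_eq_iff)
    moreover have "ring_preimage A f ?J = ring_preimage A g ?J'"
    proof -
      \<comment> \<open>Both memberships say that the common value
        \<open>\<alpha> (f a) = \<beta> (g a)\<close> is zero.\<close>
      have "f a \<in> ?J \<longleftrightarrow> g a \<in> ?J'" if "a \<in> carrier A" for a
        unfolding a_kernel_def' using that by (simp add: comm[OF that])
      then show ?thesis
        unfolding ring_preimage_def by blast
    qed
    ultimately show ?bi
      using \<alpha>.kernel_is_ideal \<beta>.kernel_is_ideal by metis
  qed
qed

end
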